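(* Let $h$ be a regularizer function on the unit simplex $\Delta_d\subset\mathbb{R}^d$ that is $K$-strongly convex with respect to the $\ell^1$ norm $\|\cdot\|_1$ (where $K>0$). Let $(\eta_n)_{n\geq1}$ be a positive nonincreasing sequence such that $\lim_{n\to\infty}n\eta_n=+\infty$ and $\eta_n=\mathcal{O}(n^{-\beta})$ for some $\beta>0$, and set $\eta_0=\eta_1$. Then, for every sequence of payoff vectors $(u_n)_{n\geq1}$ in $[-1,1]^d$, the strategy given by $x_1=Q_h(0)$ and $$x_{n+1}=Q_h\left(\eta_n\sum_{k=1}^nu_k\right),\quad n\geq1,$$ guarantees, for every $n\geq1$, the regret bound $$\max_{a\in\mathcal{A}}\frac1n\sum_{k=1}^n\langle u_k|e_a-x_k\rangle\leq\frac{h_{\max}-h_{\min}}{n\eta_n}+\frac{1}{2nK}\sum_{k=1}^n\eta_{k-1},$$ and thus leads to no regret. In particular, if $\eta_n=\eta n^{-\alpha}$ for some $\eta>0$ and $\alpha\in(0,1)$, then $$\max_{a\in\mathcal{A}}\frac1n\sum_{k=1}^n\langle u_k|e_a-x_k\rangle\leq\frac{h_{\max}-h_{\min}}{\eta n^{1-\alpha}}+\frac{\eta n^{-\alpha}}{2(1-\alpha)K}+\frac{\eta}{2Kn}.$$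
   Context: $\mathcal{A}=\{1,\dots,d\}$ is a finite set of pure actions, $\Delta_d=\{x\in\mathbb{R}^d_+:\sum_ix_i=1\}$, and $e_a$ is the $a$-th canonical basis vector. $V=\mathbb{R}^d$ carries the norm $\|\cdot\|_1$, so the dual norm is $\|\cdot\|_\infty$; $\langle u|x\rangle=\sum_iu_ix_i$. A convex function $h:\mathbb{R}^d\to\mathbb{R}\cup\{+\infty\}$ is a regularizer function on $\Delta_d$ if its effective domain $\{x:h(x)<\infty\}$ equals $\Delta_d$ and $h|_{\Delta_d}$ is strictly convex and continuous. It is $K$-strongly convex w.r.t. $\|\cdot\|$ if $h(\lambda w_1+(1-\lambda)w_2)\leq\lambda h(w_1)+(1-\lambda)h(w_2)-\frac12K\lambda(1-\lambda)\|w_2-w_1\|^2$ for all $w_1,w_2\in\mathbb{R}^d$, $\lambda\in[0,1]$. The choice map is $Q_h(y)=\arg\max_{x\in\Delta_d}\{\langle y|x\rangle-h(x)\}$ (unique maximizer). $h_{\max},h_{\min}$ are the maximum and minimum of $h$ over $\Delta_d$. A strategy (a rule determining $x_{n+1}\in\Delta_d$ from $u_1,\dots,u_n$) leads to no regret if, for every sequence $(u_n)_{n\geq1}$ with $\|u_n\|_\infty\leq1$, $\limsup_{n\to\infty}\frac1n\max_{x\in\Delta_d}\sum_{k=1}^n\langle u_k|x-x_k\rangle\leq0$. *)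

theory Defs
  imports "HOL-Analysis.Analysis" "HOL-Library.Landau_Symbols"
begin

text \<open>
  The pure actions are the elements of the finite index type \<open>'d\<close>, so that \<open>d = CARD('d)\<close>, the
  payoff space is \<open>real ^ 'd\<close>, the pairing \<open>\<langle>u|x\<rangle>\<close> is \<open>u \<bullet> x\<close> and the basis vector \<open>e\<^sub>a\<close> is
  \<open>axis a 1\<close>.  The type class norm of \<open>real ^ 'd\<close> is the Euclidean one; it is used nowhere below.
  The dual norm of the \<open>\<ell>\<^sup>1\<close> norm is the library's \<open>infnorm\<close>.
\<close>

definition unit_simplex :: "(real ^ 'd) set" where
  "unit_simplex = {x. (\<forall>a. 0 \<le> x $ a) \<and> (\<Sum>a\<in>UNIV. x $ a) = 1}"

definition l1_norm :: "real ^ 'd \<Rightarrow> real" where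
  "l1_norm x = (\<Sum>a\<in>UNIV. \<bar>x $ a\<bar>)"

text \<open>
  Functions with values in \<open>\<real> \<union> {+\<infinity>}\<close> are \<open>ereal\<close>-valued functions avoiding \<open>-\<infinity>\<close>.
  In \<open>ereal\<close> one has \<open>0 * \<infinity> = 0\<close>, so the inequalities below are trivial at \<open>\<lambda> = 0\<close> and \<open>\<lambda> = 1\<close>.
\<close>

definition convex_fun :: "(real ^ 'd \<Rightarrow> ereal) \<Rightarrow> bool" where
  "convex_fun h \<longleftrightarrow> (\<forall>w\<^sub>1 w\<^sub>2. \<forall>l\<in>{0..1::real}.
     h (l *\<^sub>R w\<^sub>1 + (1 - l) *\<^sub>R w\<^sub>2) \<le> ereal l * h w\<^sub>1 + ereal (1 - l) * h w\<^sub>2)"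

definition strictly_convex_fun_on :: "(real ^ 'd) set \<Rightarrow> (real ^ 'd \<Rightarrow> ereal) \<Rightarrow> bool" where
  "strictly_convex_fun_on S h \<longleftrightarrow> (\<forall>w\<^sub>1\<in>S. \<forall>w\<^sub>2\<in>S. w\<^sub>1 \<noteq> w\<^sub>2 \<longrightarrow> (\<forall>l\<in>{0<..<1::real}.
     h (l *\<^sub>R w\<^sub>1 + (1 - l) *\<^sub>R w\<^sub>2) < ereal l * h w\<^sub>1 + ereal (1 - l) * h w\<^sub>2))"

definition regularizer :: "(real ^ 'd \<Rightarrow> ereal) \<Rightarrow> bool" where
  "regularizer h \<longleftrightarrow>
     (\<forall>x. h x \<noteq> -\<infinity>) \<and> convex_fun h \<and> {x. h x < \<infinity>} = unit_simplex \<and>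
     strictly_convex_fun_on unit_simplex h \<and> continuous_on unit_simplex h"

definition strongly_convex_l1 :: "real \<Rightarrow> (real ^ 'd \<Rightarrow> ereal) \<Rightarrow> bool" where
  "strongly_convex_l1 K h \<longleftrightarrow> (\<forall>w\<^sub>1 w\<^sub>2. \<forall>l\<in>{0..1::real}.
     h (l *\<^sub>R w\<^sub>1 + (1 - l) *\<^sub>R w\<^sub>2)
       \<le> ereal l * h w\<^sub>1 + ereal (1 - l) * h w\<^sub>2
          - ereal (1 / 2 * K * l * (1 - l) * (l1_norm (w\<^sub>2 - w\<^sub>1))\<^sup>2))"

definition choice_map :: "(real ^ 'd \<Rightarrow> ereal) \<Rightarrow> real ^ 'd \<Rightarrow> real ^ 'd" where
  "choice_map h y = arg_max_on (\<lambda>x. ereal (y \<bullet> x) - h x) unit_simplex"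

text \<open>Both extrema are finite and attained when \<open>h\<close> is a regularizer (shown below).\<close>

definition h_max :: "(real ^ 'd \<Rightarrow> ereal) \<Rightarrow> real" where
  "h_max h = real_of_ereal (SUP x\<in>unit_simplex. h x)"

definition h_min :: "(real ^ 'd \<Rightarrow> ereal) \<Rightarrow> real" where
  "h_min h = real_of_ereal (INF x\<in>unit_simplex. h x)"

text \<open>
  A strategy maps the list \<open>[u\<^sub>1, \<dots>, u\<^sub>n]\<close> of past payoff vectors to the next mixed action
  \<open>x\<^sub>n\<^sub>+\<^sub>1\<close>.  Stages are numbered from 1: \<open>play \<sigma> u n\<close> is the action \<open>x\<^sub>n\<close> against
  \<open>(u\<^sub>n)\<^sub>n\<^sub>\<ge>\<^sub>1\<close>, and the value \<open>u 0\<close> is never used.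
\<close>

type_synonym 'd strategy = "(real ^ 'd) list \<Rightarrow> real ^ 'd"

definition play :: "'d strategy \<Rightarrow> (nat \<Rightarrow> real ^ 'd) \<Rightarrow> nat \<Rightarrow> real ^ 'd" where
  "play \<sigma> u n = \<sigma> (map u [1..<n])"

definition leads_to_no_regret :: "'d::finite strategy \<Rightarrow> bool" where
  "leads_to_no_regret \<sigma> \<longleftrightarrow>
     (\<forall>us. \<sigma> us \<in> unit_simplex) \<and>
     (\<forall>u. (\<forall>n\<ge>1. infnorm (u n) \<le> 1) \<longrightarrow>
        limsup (\<lambda>n. ereal (1 / real n) *
          (SUP x\<in>unit_simplex. ereal (\<Sum>k=1..n. u k \<bullet> (x - play \<sigma> u k)))) \<le> 0)"

definition regularized_strategy ::
    "(real ^ 'd \<Rightarrow> ereal) \<Rightarrow> (nat \<Rightarrow> real) \<Rightarrow> 'd strategy" where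
  "regularized_strategy h \<eta> us =
     (if us = [] then choice_map h 0 else choice_map h (\<eta> (length us) *\<^sub>R sum_list us))"

lemma play_regularized_strategy:
  shows "play (regularized_strategy h \<eta>) u 1 = choice_map h 0"
    and "n \<ge> 1 \<Longrightarrow>
      play (regularized_strategy h \<eta>) u (Suc n) = choice_map h (\<eta> n *\<^sub>R (\<Sum>k=1..n. u k))"
proof -
  show "play (regularized_strategy h \<eta>) u 1 = choice_map h 0"
    by (simp add: play_def regularized_strategy_def)
  assume n: "n \<ge> 1"
  have "sum_list (map u [1..<Suc n]) = (\<Sum>k=1..n. u k)"
    by (subst sum_set_upt_conv_sum_list_nat[symmetric]) (simp only: set_upt atLeastLessThanSuc_atLeastAtMost)
  moreover have "[1..<Suc n] \<noteq> []" "length [1..<Suc n] = n"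
    using n by auto
  ultimately show "play (regularized_strategy h \<eta>) u (Suc n) = choice_map h (\<eta> n *\<^sub>R (\<Sum>k=1..n. u k))"
    by (simp del: upt_Suc add: play_def regularized_strategy_def)
qed

lemma axis_in_unit_simplex: "axis a 1 \<in> unit_simplex"
  by (auto simp: unit_simplex_def axis_def)

lemma compact_unit_simplex: "compact (unit_simplex :: (real ^ 'd::finite) set)"
proof -
  have "closed (unit_simplex :: (real ^ 'd) set)"
    unfolding unit_simplex_def
    by (intro closed_Collect_conj closed_Collect_all closed_Collect_le closed_Collect_eq
        continuous_intros)
  moreover have "unit_simplex \<subseteq> cbox (0 :: real ^ 'd) 1"
  proof
    fix x :: "real ^ 'd" assume x: "x \<in> unit_simplex"
    have "x $ a \<le> 1" for a
      using member_le_sum[of a UNIV "\<lambda>a. x $ a"] x by (auto simp: unit_simplex_def)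
    then show "x \<in> cbox 0 1"
      using x by (simp add: mem_box_cart unit_simplex_def)
  qed
  ultimately show ?thesis
    by (meson bounded_cbox bounded_subset compact_eq_bounded_closed)
qed

lemma regularizer_finite:
  assumes "regularizer h" "x \<in> unit_simplex"
  shows "\<bar>h x\<bar> \<noteq> \<infinity>"
  using assms by (auto simp: regularizer_def)

lemma h_max_attained:
  assumes "regularizer (h :: real ^ 'd::finite \<Rightarrow> ereal)"
  shows "\<exists>x\<in>unit_simplex. h x = ereal (h_max h) \<and> (\<forall>y\<in>unit_simplex. h y \<le> ereal (h_max h))"
proof -
  have "unit_simplex \<noteq> ({} :: (real ^ 'd) set)" using axis_in_unit_simplex by blast
  then obtain x where x: "x \<in> unit_simplex" "\<forall>y\<in>unit_simplex. h y \<le> h x"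
    using continuous_attains_sup[OF compact_unit_simplex, of h] assms
    by (auto simp: regularizer_def)
  then have "(SUP x\<in>unit_simplex. h x) = h x"
    by (intro antisym SUP_least SUP_upper) auto
  then have "ereal (h_max h) = h x"
    using regularizer_finite[OF assms x(1)] by (simp add: h_max_def ereal_real)
  then show ?thesis using x by auto
qed

lemma h_min_attained:
  assumes "regularizer (h :: real ^ 'd::finite \<Rightarrow> ereal)"
  shows "\<exists>x\<in>unit_simplex. h x = ereal (h_min h) \<and> (\<forall>y\<in>unit_simplex. ereal (h_min h) \<le> h y)"
proof -
  have "unit_simplex \<noteq> ({} :: (real ^ 'd) set)" using axis_in_unit_simplex by blast
  then obtain x where x: "x \<in> unit_simplex" "\<forall>y\<in>unit_simplex. h x \<le> h y"
    using continuous_attains_inf[OF compact_unit_simplex, of h] assms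
    by (auto simp: regularizer_def)
  then have "(INF x\<in>unit_simplex. h x) = h x"
    by (intro antisym INF_greatest INF_lower) auto
  then have "ereal (h_min h) = h x"
    using regularizer_finite[OF assms x(1)] by (simp add: h_min_def ereal_real)
  then show ?thesis using x by auto
qed

end

theory Submission
  imports Defs
begin

text \<open>
  Put \<open>S\<^sub>n = u\<^sub>1 + \<dots> + u\<^sub>n\<close> and \<open>F\<^sub>n(x) = \<langle>S\<^sub>n|x\<rangle> - (h(x) - h\<^sub>m\<^sub>i\<^sub>n) / \<eta>\<^sub>n\<close>, so that \<open>x\<^sub>n\<^sub>+\<^sub>1\<close> maximizes
  \<open>F\<^sub>n\<close> over the simplex.  As \<open>\<eta>\<close> is nonincreasing, \<open>F\<^sub>n \<le> F\<^sub>n\<^sub>-\<^sub>1 + \<langle>u\<^sub>n|\<cdot>\<rangle>\<close>.  Strong convexity makes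
  \<open>F\<^sub>n\<^sub>-\<^sub>1\<close> drop by at least \<open>K / (2 \<eta>\<^sub>n\<^sub>-\<^sub>1) * \<parallel>x - x\<^sub>n\<parallel>\<^sub>1\<^sup>2\<close> away from its maximizer \<open>x\<^sub>n\<close>, while
  \<open>\<langle>u\<^sub>n|x - x\<^sub>n\<rangle> \<le> \<parallel>x - x\<^sub>n\<parallel>\<^sub>1\<close>; completing the square gives
  \<open>max F\<^sub>n \<le> max F\<^sub>n\<^sub>-\<^sub>1 + \<langle>u\<^sub>n|x\<^sub>n\<rangle> + \<eta>\<^sub>n\<^sub>-\<^sub>1 / (2 K)\<close>.  Summing these increments and comparing with
  \<open>max F\<^sub>n \<ge> \<langle>S\<^sub>n|x\<rangle> - (h\<^sub>m\<^sub>a\<^sub>x - h\<^sub>m\<^sub>i\<^sub>n) / \<eta>\<^sub>n\<close> yields the regret bound.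
\<close>

section \<open>Duality pairing and convexity of the simplex\<close>

lemma inner_le_l1_norm:
  fixes u v :: "real ^ 'd::finite"
  assumes "\<And>a. \<bar>u $ a\<bar> \<le> 1"
  shows "u \<bullet> v \<le> l1_norm v"
proof -
  have "u $ a * v $ a \<le> \<bar>v $ a\<bar>" for a
    using mult_right_mono[OF assms[of a], of "\<bar>v $ a\<bar>"] abs_ge_self[of "u $ a * v $ a"]
    by (simp add: abs_mult)
  then show ?thesis
    by (simp add: inner_vec_def l1_norm_def sum_mono)
qed

lemma convex_combination_in_unit_simplex:
  assumes "x \<in> unit_simplex" "y \<in> unit_simplex" "0 \<le> l" "l \<le> (1::real)"
  shows "l *\<^sub>R x + (1 - l) *\<^sub>R y \<in> unit_simplex"
  using assms by (auto simp: unit_simplex_def sum.distrib sum_distrib_left[symmetric])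

section \<open>Real values of the regularizer and the choice map\<close>

lemma regularizer_ereal_real:
  assumes "regularizer h" "x \<in> unit_simplex"
  shows "h x = ereal (real_of_ereal (h x))"
  using regularizer_finite[OF assms] by (simp add: ereal_real)

lemma regularizer_real_bounds:
  fixes h :: "real ^ 'd::finite \<Rightarrow> ereal"
  assumes "regularizer h" "x \<in> unit_simplex"
  shows "h_min h \<le> real_of_ereal (h x)" "real_of_ereal (h x) \<le> h_max h"
  using h_min_attained[OF assms(1)] h_max_attained[OF assms(1)] assms(2)
    regularizer_ereal_real[OF assms] by (metis ereal_less_eq(3))+

text \<open>\<open>choice_map\<close> is a Hilbert choice, so its properties follow once some
  maximizer exists; compactness of the simplex and continuity of \<open>h\<close> provide
  one.\<close>

lemma
  fixes h :: "real ^ 'd::finite \<Rightarrow> ereal"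
  assumes "regularizer h"
  shows choice_map_in_unit_simplex: "choice_map h y \<in> unit_simplex"
    and choice_map_maximal: "x \<in> unit_simplex \<Longrightarrow>
      y \<bullet> x - real_of_ereal (h x) \<le> y \<bullet> choice_map h y - real_of_ereal (h (choice_map h y))"
proof -
  let ?f = "\<lambda>x. y \<bullet> x - real_of_ereal (h x)"
  have "continuous_on unit_simplex h"
    using assms by (simp add: regularizer_def)
  then have "continuous_on unit_simplex (\<lambda>x. real_of_ereal (h x))"
    using continuous_on_iff_real[of unit_simplex h] regularizer_finite[OF assms]
    by (simp add: o_def)
  then have "continuous_on unit_simplex ?f"
    by (intro continuous_intros)
  moreover have "unit_simplex \<noteq> ({} :: (real ^ 'd) set)"
    using axis_in_unit_simplex by blast
  ultimately obtain p where p: "p \<in> unit_simplex" "\<And>x. x \<in> unit_simplex \<Longrightarrow> ?f x \<le> ?f p"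
    using continuous_attains_sup[OF compact_unit_simplex] by blast
  have f: "ereal (y \<bullet> x) - h x = ereal (?f x)" if "x \<in> unit_simplex" for x
    by (subst regularizer_ereal_real[OF assms that]) simp
  have "is_arg_max (\<lambda>x. ereal (y \<bullet> x) - h x) (\<lambda>x. x \<in> unit_simplex) p"
    unfolding is_arg_max_linorder using p f by auto
  then have "is_arg_max (\<lambda>x. ereal (y \<bullet> x) - h x) (\<lambda>x. x \<in> unit_simplex) (choice_map h y)"
    unfolding choice_map_def arg_max_on_def arg_max_def by (rule someI)
  then have *: "choice_map h y \<in> unit_simplex"
    "\<And>x. x \<in> unit_simplex \<Longrightarrow>
      ereal (y \<bullet> x) - h x \<le> ereal (y \<bullet> choice_map h y) - h (choice_map h y)"
    unfolding is_arg_max_linorder by auto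
  show "choice_map h y \<in> unit_simplex"
    by (rule *)
  show "?f x \<le> ?f (choice_map h y)" if "x \<in> unit_simplex"
    using *(2)[OF that] f[OF that] f[OF *(1)] by simp
qed

lemma regularized_strategy_in_unit_simplex:
  fixes h :: "real ^ 'd::finite \<Rightarrow> ereal"
  assumes "regularizer h"
  shows "regularized_strategy h \<eta> us \<in> unit_simplex"
  by (simp add: regularized_strategy_def choice_map_in_unit_simplex[OF assms])

text \<open>Compare the maximizer \<open>p\<close> with points of the segment from \<open>x\<close>
  to \<open>p\<close>. Strong convexity lifts the objective there above linear interpolation,
  maximality caps it at its value at \<open>p\<close>, and letting the point approach
  \<open>p\<close> leaves the full quadratic gap.\<close>

lemma choice_map_strongly_maximal:
  fixes h :: "real ^ 'd::finite \<Rightarrow> ereal"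
  assumes h: "regularizer h" and K: "strongly_convex_l1 K h" and x: "x \<in> unit_simplex"
  shows "y \<bullet> x - real_of_ereal (h x) + K / 2 * (l1_norm (x - choice_map h y))\<^sup>2
    \<le> y \<bullet> choice_map h y - real_of_ereal (h (choice_map h y))"
proof -
  define p where "p = choice_map h y"
  define g where "g z = real_of_ereal (h z)" for z
  define c where "c = K / 2 * (l1_norm (x - p))\<^sup>2"
  have p: "p \<in> unit_simplex"
    unfolding p_def by (rule choice_map_in_unit_simplex[OF h])
  have hg: "h z = ereal (g z)" if "z \<in> unit_simplex" for z
    unfolding g_def by (rule regularizer_ereal_real[OF h that])
  have sym: "l1_norm (p - x) = l1_norm (x - p)"
    by (simp add: l1_norm_def abs_minus_commute)
  have "c \<le> (y \<bullet> p - g p) - (y \<bullet> x - g x)"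
  \<comment> \<open>This rule stands in for the limit: it suffices that \<open>t * c\<close> is
    below the gap for all 0 < t < 1.\<close>
  proof (rule field_le_mult_one_interval)
    fix t :: real assume t: "0 < t" "t < 1"
    define z where "z = (1 - t) *\<^sub>R x + t *\<^sub>R p"
    have z: "z \<in> unit_simplex"
      using convex_combination_in_unit_simplex[OF x p, of "1 - t"] t by (simp add: z_def)
    have "h z \<le> ereal (1 - t) * h x + ereal t * h p
        - ereal (1 / 2 * K * (1 - t) * t * (l1_norm (p - x))\<^sup>2)"
      using K[unfolded strongly_convex_l1_def, rule_format, of "1 - t" x p] t by (simp add: z_def)
    then have "g z \<le> (1 - t) * g x + t * g p - (1 - t) * (t * c)"
      by (simp add: hg x p z sym c_def algebra_simps)
    moreover have "y \<bullet> z - g z \<le> y \<bullet> p - g p"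
      using choice_map_maximal[OF h z, of y] by (simp add: p_def g_def)
    moreover have "y \<bullet> z = (1 - t) * (y \<bullet> x) + t * (y \<bullet> p)"
      by (simp add: z_def inner_right_distrib)
    ultimately have "(1 - t) * (t * c) \<le> (1 - t) * ((y \<bullet> p - g p) - (y \<bullet> x - g x))"
      by (simp add: algebra_simps)
    then show "t * c \<le> (y \<bullet> p - g p) - (y \<bullet> x - g x)"
      using t by simp
  qed
  then show ?thesis
    by (simp add: p_def g_def c_def)
qed

section \<open>The regret bound\<close>

text \<open>One formula covers all stages: at stage 1 the empty sum makes the argument 0, whatever
  the value of \<open>\<eta> 0\<close>.\<close>

lemma play_eq_choice_map:
  assumes "n \<ge> 1"
  shows "play (regularized_strategy h \<eta>) u n = choice_map h (\<eta> (n - 1) *\<^sub>R (\<Sum>k=1..n-1. u k))"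
proof (cases "n = 1")
  case True
  then show ?thesis
    using play_regularized_strategy(1)[of h \<eta> u] by simp
next
  case False
  with assms show ?thesis
    using play_regularized_strategy(2)[of "n - 1" h \<eta> u] by simp
qed

text \<open>The right side is the maximum over \<open>N\<close>, attained at
  \<open>N = e / K\<close>. Here \<open>N\<close> will be the displacement between consecutive
  actions.\<close>

lemma linear_minus_square_le:
  fixes N K e :: real
  assumes "K > 0" "e > 0"
  shows "N - K / (2 * e) * N\<^sup>2 \<le> e / (2 * K)"
proof -
  have "e / (2 * K) - (N - K / (2 * e) * N\<^sup>2) = (K * N - e)\<^sup>2 / (2 * e * K)"
    using assms by (simp add: field_simps power2_eq_square)
  also have "\<dots> \<ge> 0"
    using assms by simp
  finally show ?thesis by simp
qed

lemma regularized_regret_bound: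
  fixes h :: "real ^ 'd::finite \<Rightarrow> ereal" and u :: "nat \<Rightarrow> real ^ 'd"
  assumes h: "regularizer h" and K: "K > 0" "strongly_convex_l1 K h"
    and pos: "\<And>n. \<eta> n > 0" and dec: "\<And>n. \<eta> (Suc n) \<le> \<eta> n"
    and u: "\<And>n a. n \<ge> 1 \<Longrightarrow> \<bar>u n $ a\<bar> \<le> 1"
    and x: "x \<in> unit_simplex"
  shows "(\<Sum>k=1..n. u k \<bullet> (x - play (regularized_strategy h \<eta>) u k))
    \<le> (h_max h - h_min h) / \<eta> n + 1 / (2 * K) * (\<Sum>k=1..n. \<eta> (k - 1))"
proof -
  define S where "S n = (\<Sum>k=1..n. u k)" for n
  define X where "X n = choice_map h (\<eta> n *\<^sub>R S n)" for n
  \<comment> \<open>Subtracting the minimum leaves maximizers unchanged and makes \<open>g\<close>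
    nonnegative on the simplex, so that \<open>g x / \<eta> n\<close> can only grow as
    \<open>\<eta>\<close> decreases.\<close>
  define g where "g x = real_of_ereal (h x) - h_min h" for x
  define F where "F n x = S n \<bullet> x - g x / \<eta> n" for n x
  have X: "X n \<in> unit_simplex" for n
    unfolding X_def by (rule choice_map_in_unit_simplex[OF h])
  have g0: "g x \<ge> 0" if "x \<in> unit_simplex" for x
    using regularizer_real_bounds(1)[OF h that] by (simp add: g_def)
  have F_max: "F n x + K / (2 * \<eta> n) * (l1_norm (x - X n))\<^sup>2 \<le> F n (X n)"
    if "x \<in> unit_simplex" for n x
  proof -
    \<comment> \<open>This concerns \<open>\<eta> n * F n x\<close>; dividing by
      \<open>\<eta> n\<close> turns the modulus \<open>K / 2\<close> into
      \<open>K / (2 * \<eta> n)\<close>.\<close>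
    have "\<eta> n * (S n \<bullet> x) - g x + K / 2 * (l1_norm (x - X n))\<^sup>2 \<le> \<eta> n * (S n \<bullet> X n) - g (X n)"
      using choice_map_strongly_maximal[OF h K(2) that, of "\<eta> n *\<^sub>R S n"]
      by (simp add: g_def X_def)
    from divide_right_mono[OF this, of "\<eta> n"] show ?thesis
      using pos[of n] by (simp add: F_def add_divide_distrib diff_divide_distrib)
  qed
  have step: "F (Suc n) (X (Suc n)) \<le> F n (X n) + u (Suc n) \<bullet> X n + \<eta> n / (2 * K)" for n
  proof -
    let ?x = "X (Suc n)"
    have "g ?x / \<eta> n \<le> g ?x / \<eta> (Suc n)"
      using g0[OF X] pos dec by (intro divide_left_mono) auto
    then have "F (Suc n) ?x \<le> F n ?x + u (Suc n) \<bullet> ?x"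
      by (simp add: F_def S_def inner_left_distrib)
    moreover have "u (Suc n) \<bullet> ?x \<le> u (Suc n) \<bullet> X n + l1_norm (?x - X n)"
      using inner_le_l1_norm[of "u (Suc n)" "?x - X n"] u by (simp add: inner_diff_right)
    ultimately show ?thesis
      using F_max[OF X, of n "Suc n"] linear_minus_square_le[OF K(1) pos, of "l1_norm (?x - X n)" n]
      by linarith
  qed
  have "F n (X n) \<le> (\<Sum>k=1..n. u k \<bullet> X (k - 1)) + 1 / (2 * K) * (\<Sum>k=1..n. \<eta> (k - 1))"
  proof (induction n)
    \<comment> \<open>Both sums are empty and \<open>S 0 = 0\<close>, so \<open>F 0\<close> is minus
      a nonnegative quantity.\<close>
    case 0
    then show ?case
      using g0[OF X] pos by (simp add: F_def S_def less_imp_le)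
  next
    case (Suc n)
    then show ?case
      using step[of n] by (simp add: algebra_simps)
  qed
  moreover have "F n x \<le> F n (X n)"
    using F_max[OF x, of n] K(1) pos[of n]
    by (smt (verit) divide_nonneg_pos mult_nonneg_nonneg zero_le_power2)
  moreover have "g x / \<eta> n \<le> (h_max h - h_min h) / \<eta> n"
    using regularizer_real_bounds(2)[OF h x] pos[of n]
    by (intro divide_right_mono) (auto simp: g_def)
  moreover have "(\<Sum>k=1..n. u k \<bullet> (x - play (regularized_strategy h \<eta>) u k))
      = S n \<bullet> x - (\<Sum>k=1..n. u k \<bullet> X (k - 1))"
    by (simp add: S_def X_def play_eq_choice_map inner_diff_right sum_subtractf inner_sum_left)
  ultimately show ?thesis
    by (simp add: F_def)
qed

text \<open>Vertices \<open>x\<close> give the maximum over pure actions, general \<open>x\<close>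
  the supremum in \<open>leads_to_no_regret\<close>. At \<open>n = 0\<close> both sides vanish, as
  division by zero gives 0.\<close>

lemma regularized_mean_regret_bound:
  fixes h :: "real ^ 'd::finite \<Rightarrow> ereal" and u :: "nat \<Rightarrow> real ^ 'd"
  assumes "regularizer h" "K > 0" "strongly_convex_l1 K h"
    "\<And>n. \<eta> n > 0" "\<And>n. \<eta> (Suc n) \<le> \<eta> n" "\<And>n a. n \<ge> 1 \<Longrightarrow> \<bar>u n $ a\<bar> \<le> 1"
    "x \<in> unit_simplex"
  shows "1 / real n * (\<Sum>k=1..n. u k \<bullet> (x - play (regularized_strategy h \<eta>) u k))
    \<le> (h_max h - h_min h) / (real n * \<eta> n) + 1 / (2 * real n * K) * (\<Sum>k=1..n. \<eta> (k - 1))"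
proof -
  have "1 / real n * (\<Sum>k=1..n. u k \<bullet> (x - play (regularized_strategy h \<eta>) u k))
    \<le> 1 / real n * ((h_max h - h_min h) / \<eta> n + 1 / (2 * K) * (\<Sum>k=1..n. \<eta> (k - 1)))"
    using regularized_regret_bound[where \<eta> = \<eta> and u = u, OF assms] by (intro mult_left_mono) auto
  then show ?thesis
    by (simp add: distrib_left mult.assoc mult.left_commute)
qed

section \<open>Cesaro means and sums of powers\<close>

text \<open>The terms before \<open>N\<close> contribute at most a constant \<open>C\<close>, the
  later ones at most \<open>e / 2\<close> each; for large \<open>n\<close> the constant is below
  \<open>n * e / 2\<close> too.\<close>

lemma cesaro_mean_null:
  fixes f :: "nat \<Rightarrow> real"
  assumes "f \<longlonglongrightarrow> 0"
  shows "(\<lambda>n. (\<Sum>k<n. f k) / real n) \<longlonglongrightarrow> 0"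
proof (rule LIMSEQ_I)
  fix e :: real assume "e > 0"
  then obtain N where "\<And>k. k \<ge> N \<Longrightarrow> \<bar>f k\<bar> < e / 2"
    using LIMSEQ_D[OF assms, of "e / 2"] by auto
  then have N: "\<bar>f k\<bar> \<le> e / 2" if "k \<ge> N" for k
    using that by (simp add: less_imp_le)
  define C where "C = (\<Sum>k<N. \<bar>f k\<bar>)"
  have bound: "\<bar>\<Sum>k<n. f k\<bar> \<le> C + real n * (e / 2)" if "n \<ge> N" for n
    using that
  proof (induction n rule: dec_induct)
    case base
    have "\<bar>\<Sum>k<N. f k\<bar> \<le> C"
      unfolding C_def by (rule sum_abs)
    then show ?case
      using \<open>e > 0\<close> by (simp add: add_increasing2)
  next
    case (step n)
    then show ?case
      using N[of n] abs_triangle_ineq[of "\<Sum>k<n. f k" "f n"]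
      by (simp add: distrib_right add_divide_distrib)
  qed
  obtain M where M: "C / (e / 2) < real M"
    using reals_Archimedean2 by blast
  have less: "\<bar>\<Sum>k<n. f k\<bar> < real n * e" if "n \<ge> max N M" for n
  proof -
    have "C < real n * (e / 2)"
      using M that \<open>e > 0\<close> by (simp add: field_simps) (smt (verit) mult_left_mono of_nat_mono)
    with bound[of n] that show ?thesis
      by simp
  qed
  \<comment> \<open>The successor ensures n > 0 for the division.\<close>
  have "norm ((\<Sum>k<n. f k) / real n - 0) < e" if "n \<ge> Suc (max N M)" for n
    using less[of n] that by (simp add: field_simps Suc_le_eq)
  then show "\<exists>no. \<forall>n\<ge>no. norm ((\<Sum>k<n. f k) / real n - 0) < e"
    by blast
qed

text \<open>The right side is the integral of \<open>t powr (- \<alpha>)\<close> from 0 to n. By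
  induction only one increment is compared, using Young's inequality instead of integration.\<close>

lemma sum_powr_minus_le:
  fixes \<alpha> :: real
  assumes "0 < \<alpha>" "\<alpha> < 1"
  shows "(\<Sum>k=1..n. real k powr (- \<alpha>)) \<le> real n powr (1 - \<alpha>) / (1 - \<alpha>)"
proof (induction n)
  case 0
  then show ?case by simp
next
  case (Suc n)
  define m where "m = real (Suc n)"
  have m: "m > 0" "real n = m - 1"
    by (simp_all add: m_def)
  \<comment> \<open>Weighted AM-GM with weights 1 - \<alpha> and \<alpha>; multiplying by
    \<open>m powr (- \<alpha>)\<close> afterwards isolates
    \<open>real n powr (1 - \<alpha>)\<close>.\<close>
  have "real n powr (1 - \<alpha>) * m powr \<alpha> \<le> (1 - \<alpha>) * real n + \<alpha> * m"
    using assms m by (cases "n = 0") (auto intro!: Youngs_inequality_0)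
  also have "\<dots> = m - (1 - \<alpha>)"
    by (simp add: m algebra_simps)
  finally have "real n powr (1 - \<alpha>) * m powr \<alpha> * m powr (- \<alpha>) \<le> (m - (1 - \<alpha>)) * m powr (- \<alpha>)"
    by (rule mult_right_mono) simp
  moreover have "m powr \<alpha> * m powr (- \<alpha>) = 1" "m * m powr (- \<alpha>) = m powr (1 - \<alpha>)"
    using m by (simp_all add: powr_mult_base flip: powr_add)
  ultimately have "real n powr (1 - \<alpha>) + (1 - \<alpha>) * m powr (- \<alpha>) \<le> m powr (1 - \<alpha>)"
    by (simp add: mult.assoc left_diff_distrib)
  from divide_right_mono[OF this, of "1 - \<alpha>"]
  have "real n powr (1 - \<alpha>) / (1 - \<alpha>) + m powr (- \<alpha>) \<le> m powr (1 - \<alpha>) / (1 - \<alpha>)"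
    using assms by (simp add: add_divide_distrib)
  with Suc show ?case
    by (simp add: m_def)
qed

section \<open>From the regret bound to no regret\<close>

text \<open>The mean regret bound is uniform in \<open>x\<close> and tends to 0: its first term
  because \<open>n * \<eta> n\<close> diverges, its second as a Cesaro mean of a null
  sequence.\<close>

lemma regularized_strategy_no_regret:
  fixes h :: "real ^ 'd::finite \<Rightarrow> ereal"
  assumes h: "regularizer h" and K: "K > 0" "strongly_convex_l1 K h"
    and pos: "\<And>n. \<eta> n > 0" and dec: "\<And>n. \<eta> (Suc n) \<le> \<eta> n"
    and lim: "filterlim (\<lambda>n. real n * \<eta> n) at_top sequentially" and null: "\<eta> \<longlonglongrightarrow> 0"
  shows "leads_to_no_regret (regularized_strategy h \<eta>)"
  unfolding leads_to_no_regret_def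
proof (intro conjI allI impI)
  show "regularized_strategy h \<eta> us \<in> unit_simplex" for us
    by (rule regularized_strategy_in_unit_simplex[OF h])
next
  fix u :: "nat \<Rightarrow> real ^ 'd"
  assume u: "\<forall>n\<ge>1. infnorm (u n) \<le> 1"
  define B where
    "B n = (h_max h - h_min h) / (real n * \<eta> n) + 1 / (2 * K) * ((\<Sum>k<n. \<eta> k) / real n)" for n
  define R where "R n x = (\<Sum>k=1..n. u k \<bullet> (x - play (regularized_strategy h \<eta>) u k))" for n x
  have u': "\<bar>u n $ a\<bar> \<le> 1" if "n \<ge> 1" for n a
    using order_trans[OF component_le_infnorm_cart] u that by blast
  have shift: "(\<Sum>k=1..n. \<eta> (k - 1)) = (\<Sum>k<n. \<eta> k)" for n
    by (induction n) auto
  have bound: "1 / real n * R n x \<le> B n" if "x \<in> unit_simplex" for n x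
    using regularized_mean_regret_bound[where \<eta> = \<eta> and u = u, OF h K pos dec u' that, of n]
    by (simp add: B_def R_def shift[simplified] mult_ac)
  have "(\<lambda>n. (h_max h - h_min h) / (real n * \<eta> n)) \<longlonglongrightarrow> 0"
    by (intro tendsto_divide_0[OF tendsto_const] filterlim_at_top_imp_at_infinity lim)
  moreover have "(\<lambda>n. 1 / (2 * K) * ((\<Sum>k<n. \<eta> k) / real n)) \<longlonglongrightarrow> 1 / (2 * K) * 0"
    by (intro tendsto_mult tendsto_const cesaro_mean_null null)
  ultimately have "B \<longlonglongrightarrow> 0"
    unfolding B_def using tendsto_add by fastforce
  then have "(\<lambda>n. ereal (B n)) \<longlonglongrightarrow> ereal 0"
    by (rule tendsto_ereal)
  then have "limsup (\<lambda>n. ereal (B n)) = 0"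
    by (simp add: lim_imp_Limsup zero_ereal_def)
  moreover have "ereal (1 / real n) * (SUP x\<in>unit_simplex. ereal (R n x)) \<le> ereal (B n)"
    if "n \<ge> 1" for n
  proof -
    \<comment> \<open>Clearing the factor 1/n bounds the supremum itself; the factor then returns in
      \<open>ereal\<close> and cancels since n \<ge> 1.\<close>
    have "R n x \<le> real n * B n" if "x \<in> unit_simplex" for x
      using bound[OF that, of n] \<open>n \<ge> 1\<close> by (simp add: field_simps)
    then have "(SUP x\<in>unit_simplex. ereal (R n x)) \<le> ereal (real n * B n)"
      by (intro SUP_least) simp
    then have "ereal (1 / real n) * (SUP x\<in>unit_simplex. ereal (R n x))
        \<le> ereal (1 / real n) * ereal (real n * B n)"
      by (rule ereal_mult_left_mono) simp
    then show ?thesis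
      using that by simp
  qed
  then have "\<forall>\<^sub>F n in sequentially.
      ereal (1 / real n) * (SUP x\<in>unit_simplex. ereal (R n x)) \<le> ereal (B n)"
    using eventually_sequentially by blast
  ultimately show "limsup (\<lambda>n. ereal (1 / real n) *
      (SUP x\<in>unit_simplex. ereal (\<Sum>k=1..n. u k \<bullet> (x - play (regularized_strategy h \<eta>) u k)))) \<le> 0"
    unfolding R_def using Limsup_mono by fastforce
qed

text \<open>A nonempty history has length at least 1, and the empty one is answered by
  \<open>choice_map h 0\<close>. This permits resetting \<open>\<eta> 0\<close> in the power-law
  case.\<close>

lemma regularized_strategy_cong:
  fixes h :: "real ^ 'd \<Rightarrow> ereal"
  assumes "\<And>n. n \<ge> 1 \<Longrightarrow> \<eta> n = \<eta>' n"
  shows "regularized_strategy h \<eta> = regularized_strategy h \<eta>'"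
proof
  fix us :: "(real ^ 'd) list"
  show "regularized_strategy h \<eta> us = regularized_strategy h \<eta>' us"
    using assms[of "length us"] by (cases us) (auto simp: regularized_strategy_def)
qed

section \<open>General step sizes and the power-law case\<close>

theorem proposition6p2:
  fixes h :: "real ^ 'd::finite \<Rightarrow> ereal" and K :: real
  assumes "regularizer h" and "K > 0" and "strongly_convex_l1 K h"
  shows "(\<forall>\<eta> :: nat \<Rightarrow> real.
      (\<forall>n\<ge>1. \<eta> n > 0) \<and>
      (\<forall>n\<ge>1. \<eta> (Suc n) \<le> \<eta> n) \<and>
      filterlim (\<lambda>n. real n * \<eta> n) at_top sequentially \<and>
      (\<exists>\<beta>>0. \<eta> \<in> O(\<lambda>n. real n powr (- \<beta>))) \<and>
      \<eta> 0 = \<eta> 1 \<longrightarrow>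
      (\<forall>u :: nat \<Rightarrow> real ^ 'd. (\<forall>n\<ge>1. \<forall>a. u n $ a \<in> {-1..1}) \<longrightarrow>
        (\<forall>n\<ge>1.
          (MAX a\<in>UNIV. 1 / real n *
             (\<Sum>k=1..n. u k \<bullet> (axis a 1 - play (regularized_strategy h \<eta>) u k)))
          \<le> (h_max h - h_min h) / (real n * \<eta> n)
             + 1 / (2 * real n * K) * (\<Sum>k=1..n. \<eta> (k - 1)))) \<and>
      leads_to_no_regret (regularized_strategy h \<eta>))
    \<and>
    (\<forall>(c::real) (\<alpha>::real) \<eta> :: nat \<Rightarrow> real.
      c > 0 \<and> 0 < \<alpha> \<and> \<alpha> < 1 \<and> (\<forall>n\<ge>1. \<eta> n = c * real n powr (- \<alpha>)) \<longrightarrow>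
      (\<forall>u :: nat \<Rightarrow> real ^ 'd. (\<forall>n\<ge>1. \<forall>a. u n $ a \<in> {-1..1}) \<longrightarrow>
        (\<forall>n\<ge>1.
          (MAX a\<in>UNIV. 1 / real n *
             (\<Sum>k=1..n. u k \<bullet> (axis a 1 - play (regularized_strategy h \<eta>) u k)))
          \<le> (h_max h - h_min h) / (c * real n powr (1 - \<alpha>))
             + c * real n powr (- \<alpha>) / (2 * (1 - \<alpha>) * K)
             + c / (2 * K * real n))))"
proof (intro conjI allI impI)
  fix \<eta> :: "nat \<Rightarrow> real"
  assume "(\<forall>n\<ge>1. \<eta> n > 0) \<and> (\<forall>n\<ge>1. \<eta> (Suc n) \<le> \<eta> n) \<and>
      filterlim (\<lambda>n. real n * \<eta> n) at_top sequentially \<and>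
      (\<exists>\<beta>>0. \<eta> \<in> O(\<lambda>n. real n powr (- \<beta>))) \<and> \<eta> 0 = \<eta> 1"
  then obtain \<beta> where pos1: "\<forall>n\<ge>1. \<eta> n > 0" and dec1: "\<forall>n\<ge>1. \<eta> (Suc n) \<le> \<eta> n"
    and lim: "filterlim (\<lambda>n. real n * \<eta> n) at_top sequentially"
    and \<beta>: "\<beta> > 0" "\<eta> \<in> O(\<lambda>n. real n powr (- \<beta>))" and 0: "\<eta> 0 = \<eta> 1"
    by blast
  \<comment> \<open>The convention \<open>\<eta> 0 = \<eta> 1\<close> carries positivity and
    monotonicity down to index 0.\<close>
  have pos: "\<eta> n > 0" for n
    using pos1 0 by (cases n) auto
  have dec: "\<eta> (Suc n) \<le> \<eta> n" for n
    using dec1 0 by (cases n) auto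
  {
    fix u :: "nat \<Rightarrow> real ^ 'd" and n :: nat
    assume u: "\<forall>n\<ge>1. \<forall>a. u n $ a \<in> {-1..1}"
    then have u': "\<bar>u n $ a\<bar> \<le> 1" if "n \<ge> 1" for n a
      using that by (auto simp: abs_le_iff)
    show "(MAX a\<in>UNIV. 1 / real n *
             (\<Sum>k=1..n. u k \<bullet> (axis a 1 - play (regularized_strategy h \<eta>) u k)))
          \<le> (h_max h - h_min h) / (real n * \<eta> n)
             + 1 / (2 * real n * K) * (\<Sum>k=1..n. \<eta> (k - 1))"
      using regularized_mean_regret_bound[where \<eta> = \<eta> and u = u, OF assms pos dec u' axis_in_unit_simplex]
      by (subst Max_le_iff) auto
  }
  \<comment> \<open>The decay rate enters only through
    \<open>\<eta> \<longlonglongrightarrow> 0\<close>, derived as O of an o(1) sequence.\<close>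
  have "(\<lambda>n. real n powr (- \<beta>)) \<longlonglongrightarrow> 0"
    using \<beta>(1) by (intro tendsto_neg_powr filterlim_real_sequentially) auto
  then have "(\<lambda>n. real n powr (- \<beta>)) \<in> o(\<lambda>_. 1)"
    by (intro smalloI_tendsto) auto
  then have "\<eta> \<longlonglongrightarrow> 0"
    using landau_o.big_small_trans[OF \<beta>(2)] smalloD_tendsto by fastforce
  with pos dec lim show "leads_to_no_regret (regularized_strategy h \<eta>)"
    by (intro regularized_strategy_no_regret[OF assms])
next
  fix c \<alpha> :: real and \<eta> :: "nat \<Rightarrow> real" and u :: "nat \<Rightarrow> real ^ 'd" and n :: nat
  assume "c > 0 \<and> 0 < \<alpha> \<and> \<alpha> < 1 \<and> (\<forall>n\<ge>1. \<eta> n = c * real n powr (- \<alpha>))"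
  then have c: "c > 0" and \<alpha>: "0 < \<alpha>" "\<alpha> < 1"
    and \<eta>: "\<And>n. n \<ge> 1 \<Longrightarrow> \<eta> n = c * real n powr (- \<alpha>)"
    by auto
  assume "\<forall>n\<ge>1. \<forall>a. u n $ a \<in> {-1..1}" and n: "1 \<le> n"
  then have u: "\<bar>u n $ a\<bar> \<le> 1" if "n \<ge> 1" for n a
    using that by (auto simp: abs_le_iff)
  \<comment> \<open>The \<open>max\<close> enforces \<open>\<eta>' 0 = \<eta>' 1 = c\<close>, so
    that the general bound applies to \<eta>'.\<close>
  define \<eta>' where "\<eta>' n = c * real (max 1 n) powr (- \<alpha>)" for n
  have strategy: "regularized_strategy h \<eta> = regularized_strategy h \<eta>'"
    by (rule regularized_strategy_cong) (simp add: \<eta> \<eta>'_def max_def)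
  have pos: "\<eta>' n > 0" for n
    using c by (simp add: \<eta>'_def)
  have dec: "\<eta>' (Suc n) \<le> \<eta>' n" for n
    unfolding \<eta>'_def using c \<alpha> by (intro mult_left_mono powr_mono2') auto
  obtain m where m: "n = Suc m"
    using n by (cases n) auto
  \<comment> \<open>The split-off term \<open>\<eta>' 0 = c\<close> produces the summand
    \<open>c / (2 * K * real n)\<close>; the remaining sum up to m = n - 1 is then bounded by the
    integral up to n.\<close>
  have "(\<Sum>k=1..n. \<eta>' (k - 1)) = \<eta>' 0 + (\<Sum>k=1..m. \<eta>' k)"
    unfolding m by (induction m) auto
  also have "\<dots> = c + c * (\<Sum>k=1..m. real k powr (- \<alpha>))"
    by (simp add: \<eta>'_def sum_distrib_left max_def)
  also have "(\<Sum>k=1..m. real k powr (- \<alpha>)) \<le> real n powr (1 - \<alpha>) / (1 - \<alpha>)"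
  proof (rule order_trans[OF sum_powr_minus_le[OF \<alpha>]])
    show "real m powr (1 - \<alpha>) / (1 - \<alpha>) \<le> real n powr (1 - \<alpha>) / (1 - \<alpha>)"
      using \<alpha> by (intro divide_right_mono powr_mono2) (auto simp: m)
  qed
  finally have sum: "(\<Sum>k=1..n. \<eta>' (k - 1)) \<le> c + c * (real n powr (1 - \<alpha>) / (1 - \<alpha>))"
    using c by simp
  have powr: "real n powr (1 - \<alpha>) = real n * real n powr (- \<alpha>)"
    using n by (simp add: powr_mult_base)
  have "1 / (2 * real n * K) * (\<Sum>k=1..n. \<eta>' (k - 1))
      \<le> 1 / (2 * real n * K) * (c + c * (real n powr (1 - \<alpha>) / (1 - \<alpha>)))"
    using sum assms(2) by (intro mult_left_mono) auto
  also have "\<dots> = c * real n powr (- \<alpha>) / (2 * (1 - \<alpha>) * K) + c / (2 * K * real n)"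
    unfolding powr using n \<alpha> assms(2) by (simp add: field_simps)
  finally have tail: "1 / (2 * real n * K) * (\<Sum>k=1..n. \<eta>' (k - 1))
      \<le> c * real n powr (- \<alpha>) / (2 * (1 - \<alpha>) * K) + c / (2 * K * real n)" .
  have head: "real n * \<eta>' n = c * real n powr (1 - \<alpha>)"
    unfolding powr using n by (simp add: \<eta>'_def max_def)
  have "1 / real n * (\<Sum>k=1..n. u k \<bullet> (axis a 1 - play (regularized_strategy h \<eta>) u k))
      \<le> (h_max h - h_min h) / (c * real n powr (1 - \<alpha>))
         + c * real n powr (- \<alpha>) / (2 * (1 - \<alpha>) * K) + c / (2 * K * real n)" for a
    using regularized_mean_regret_bound[where \<eta> = \<eta>' and u = u,
        OF assms pos dec u axis_in_unit_simplex, of n a] tail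
    unfolding strategy head by linarith
  then show "(MAX a\<in>UNIV. 1 / real n *
         (\<Sum>k=1..n. u k \<bullet> (axis a 1 - play (regularized_strategy h \<eta>) u k)))
      \<le> (h_max h - h_min h) / (c * real n powr (1 - \<alpha>))
         + c * real n powr (- \<alpha>) / (2 * (1 - \<alpha>) * K) + c / (2 * K * real n)"
    by (subst Max_le_iff) auto
qed

end
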